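(* Let $\alpha,\beta,\gamma,\delta,r,\sigma,\kappa,\lambda,\mu,\mathcal A$ be real constants with $\beta,\gamma,\sigma,\lambda\neq0$ and $\mathcal A>0$, let $\Delta_1=e^{-\delta}$, and let $$f(\zeta)=-\frac{\gamma}{\beta}(\alpha+\beta\zeta)\left(\delta+\log|\alpha+\beta\zeta|\right).$$ Then the function $$u(x,t)=\frac{\Delta_1}{\beta}\exp\left(\frac{e^{\gamma t}\left(\sigma\left(\kappa\sigma+\gamma\mu\left(2\sqrt2-2\lambda-\gamma\mu e^{\gamma t}+2\gamma\sigma t\right)\right)-4r\gamma^2\mu t\right)}{8\gamma\sigma}\right)|x|^{\frac{\gamma\mu}{2\sigma}e^{\gamma t}}-\frac{\alpha}{\beta}$$ is a solution, for $x\neq0$, of the equation $$u_t+\tfrac12\sigma^2x^2u_{xx}+r x u_x+f(u)=0,$$ and it satisfies the barrier condition $u(H(t),t)=R(t)$ for all $t$, where $$H(t)=\mathcal A\, e^{\frac12(2r-\sigma^2)t+\frac12\sigma\left(\lambda t+\mu e^{\gamma t}\right)}$$ and $$R(t)=\frac{\Delta_1}{\beta}\exp\left(\frac{e^{\gamma t}\left(\sigma\left(\gamma\mu\left(2\sqrt2-2\lambda+2\gamma\lambda t+\gamma\mu e^{\gamma t}\right)+\kappa\sigma\right)+4\gamma^2\mu\log\mathcal A\right)}{8\gamma\sigma}\right)-\frac{\alpha}{\beta}.$$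
   Context: $u=u(x,t)$ is a real-valued function; subscripts denote partial derivatives; $\log$ is the natural logarithm. $H$ is the barrier function and $R$ the rebate function of a (down-and-out) barrier option, and the barrier condition is $u(H(t),t)=R(t)$. *)

theory Defs
  imports "HOL-Analysis.Analysis"
begin

definition deriv_x :: "(real \<Rightarrow> real \<Rightarrow> real) \<Rightarrow> real \<Rightarrow> real \<Rightarrow> real" where
  "deriv_x u x t = deriv (\<lambda>y. u y t) x"

definition deriv_t :: "(real \<Rightarrow> real \<Rightarrow> real) \<Rightarrow> real \<Rightarrow> real \<Rightarrow> real" where
  "deriv_t u x t = deriv (\<lambda>s. u x s) t"

(* deriv is an arbitrary value where the derivative does not exist, so the existence of
   the partial derivatives entering the equation is demanded explicitly. *)
definition C12_on :: "(real \<times> real) set \<Rightarrow> (real \<Rightarrow> real \<Rightarrow> real) \<Rightarrow> bool" where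
  "C12_on \<Omega> u \<longleftrightarrow>
     (\<forall>(x, t) \<in> \<Omega>.
        (\<lambda>s. u x s) differentiable (at t) \<and>
        (\<lambda>y. u y t) differentiable (at x) \<and>
        (\<lambda>y. deriv_x u y t) differentiable (at x)) \<and>
     continuous_on \<Omega> (\<lambda>(x, t). u x t) \<and>
     continuous_on \<Omega> (\<lambda>(x, t). deriv_t u x t) \<and>
     continuous_on \<Omega> (\<lambda>(x, t). deriv_x u x t) \<and>
     continuous_on \<Omega> (\<lambda>(x, t). deriv_x (deriv_x u) x t)"

definition semilinear_BS_solution_on ::
  "(real \<times> real) set \<Rightarrow> real \<Rightarrow> real \<Rightarrow> (real \<Rightarrow> real) \<Rightarrow> (real \<Rightarrow> real \<Rightarrow> real) \<Rightarrow> bool" where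
  "semilinear_BS_solution_on \<Omega> \<sigma> r f u \<longleftrightarrow>
     C12_on \<Omega> u \<and>
     (\<forall>(x, t) \<in> \<Omega>.
        deriv_t u x t + 1 / 2 * \<sigma>\<^sup>2 * x\<^sup>2 * deriv_x (deriv_x u) x t
          + r * x * deriv_x u x t + f (u x t) = 0)"

definition barrier_condition ::
  "(real \<Rightarrow> real \<Rightarrow> real) \<Rightarrow> (real \<Rightarrow> real) \<Rightarrow> (real \<Rightarrow> real) \<Rightarrow> bool" where
  "barrier_condition u H R \<longleftrightarrow> (\<forall>t. u (H t) t = R t)"

end

theory Submission
  imports Defs
begin

text \<open>
  The substitution \<open>v = \<alpha> + \<beta> u\<close> turns the equation into
  \<open>v\<^sub>t + \<sigma>\<^sup>2 x\<^sup>2 v\<^sub>x\<^sub>x / 2 + r x v\<^sub>x = \<gamma> v (\<delta> + ln \<bar>v\<bar>)\<close>.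
  A logarithmic source becomes linear in the exponent: for \<open>v = exp (\<phi> - \<delta>)\<close> the right-hand side
  is \<open>\<gamma> v \<phi>\<close>. The differential operator has the Euler form \<open>x \<partial>\<^sub>x\<close>, so an exponent affine in
  \<open>ln \<bar>x\<bar>\<close>, \<open>\<phi> = g(t) + a(t) ln \<bar>x\<bar>\<close>, contributes only functions of \<open>t\<close> through its
  \<open>x\<close>-derivatives. Dividing by \<open>v\<close> and comparing the coefficients of \<open>1\<close> and \<open>ln \<bar>x\<bar>\<close> leaves
  the two ordinary differential equations
  \<open>a' = \<gamma> a\<close> and \<open>g' = \<gamma> g - \<sigma>\<^sup>2 (a\<^sup>2 - a) / 2 - r a\<close>.
  Lemma \<open>log_affine_exponent_solution\<close> shows that they suffice. The given \<open>u\<close> is the case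
  \<open>a(t) = \<gamma> \<mu> exp (\<gamma> t) / (2 \<sigma>)\<close>, and \<open>g\<close> is
  the solution of the second equation for this \<open>a\<close> whose free multiple of \<open>exp (\<gamma> t)\<close> is
  fixed by \<open>\<kappa>\<close>, \<open>l\<close> and \<open>sqrt 2\<close>.

  The barrier condition is the algebraic identity obtained by inserting
  \<open>ln (H t) = ln A + (2 r - \<sigma>\<^sup>2) t / 2 + \<sigma> (l t + \<mu> exp (\<gamma> t)) / 2\<close> into the exponent.
\<close>

text \<open>
  Near \<open>x\<close> the sign is constant, so the absolute value is multiplication by \<open>sgn x\<close>, a
  constant factor that the logarithmic derivative does not see.
\<close>

lemma has_real_derivative_ln_abs:
  fixes x :: real
  assumes "x \<noteq> 0"
  shows "((\<lambda>y. ln \<bar>y\<bar>) has_real_derivative 1 / x) (at x)"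
proof (rule has_field_derivative_transform_within_open)
  show "((\<lambda>y. ln (sgn x * y)) has_real_derivative 1 / x) (at x)"
    using assms by (auto intro!: derivative_eq_intros simp: sgn_if)
  show "open {y. sgn x * y > 0}"
    by (intro open_Collect_less continuous_intros)
  show "ln (sgn x * y) = ln \<bar>y\<bar>" if "y \<in> {y. sgn x * y > 0}" for y
    using that by (auto simp: sgn_if split: if_splits)
qed (use assms in \<open>simp add: sgn_if\<close>)

text \<open>
  All the partial derivatives are multiples of \<open>w = u + \<alpha> / \<beta>\<close>, with factors that are functions
  of \<open>t\<close>, powers of \<open>x\<close> and \<open>ln \<bar>x\<bar>\<close>. This gives both the regularity away from \<open>x = 0\<close> and,
  since \<open>\<alpha> + \<beta> u = \<beta> w\<close>, a common factor \<open>w\<close> in the equation.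
\<close>

lemma log_affine_exponent_solution:
  fixes \<alpha> \<beta> \<gamma> \<delta> \<sigma> r :: real and a g :: "real \<Rightarrow> real"
    and u :: "real \<Rightarrow> real \<Rightarrow> real"
  assumes \<beta>: "\<beta> \<noteq> 0"
    and a': "\<And>t. (a has_real_derivative \<gamma> * a t) (at t)"
    and g': "\<And>t. (g has_real_derivative
                    \<gamma> * g t - \<sigma>\<^sup>2 / 2 * ((a t)\<^sup>2 - a t) - r * a t) (at t)"
    and u: "\<And>x t. x \<noteq> 0 \<Longrightarrow>
              u x t = exp (- \<delta>) / \<beta> * exp (g t + a t * ln \<bar>x\<bar>) - \<alpha> / \<beta>"
  shows "semilinear_BS_solution_on {(x, t). x \<noteq> 0} \<sigma> r
           (\<lambda>\<zeta>. - (\<gamma> / \<beta>) * (\<alpha> + \<beta> * \<zeta>) * (\<delta> + ln \<bar>\<alpha> + \<beta> * \<zeta>\<bar>)) u"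
proof -
  define \<phi> where "\<phi> x t = g t + a t * ln \<bar>x\<bar>" for x t
  define w where "w x t = exp (- \<delta>) / \<beta> * exp (\<phi> x t)" for x t
  define g1 where "g1 t = \<gamma> * g t - \<sigma>\<^sup>2 / 2 * ((a t)\<^sup>2 - a t) - r * a t" for t
  let ?\<Omega> = "{(x, t). x \<noteq> 0} :: (real \<times> real) set"

  have u_w: "u x t = w x t - \<alpha> / \<beta>" if "x \<noteq> 0" for x t
    using u[OF that] by (simp add: w_def \<phi>_def)
  have open_nz: "open {x::real. x \<noteq> 0}"
    by (simp add: open_Collect_neq)

  have w_x: "((\<lambda>y. w y t) has_real_derivative a t / x * w x t) (at x)" if "x \<noteq> 0" for x t
    unfolding w_def \<phi>_def
    by (rule derivative_eq_intros has_real_derivative_ln_abs that refl)+ (use that in simp)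
  have u_x: "((\<lambda>y. u y t) has_real_derivative a t / x * w x t) (at x)" if "x \<noteq> 0" for x t
  proof (rule has_field_derivative_transform_within_open[OF _ open_nz])
    show "((\<lambda>y. w y t - \<alpha> / \<beta>) has_real_derivative a t / x * w x t) (at x)"
      using DERIV_diff[OF w_x[OF that] DERIV_const] by simp
  qed (use that u_w in auto)
  have dx: "deriv_x u x t = a t / x * w x t" if "x \<noteq> 0" for x t
    using DERIV_imp_deriv[OF u_x[OF that]] by (simp add: deriv_x_def)
  have u_xx: "((\<lambda>y. deriv_x u y t) has_real_derivative ((a t)\<^sup>2 - a t) / x\<^sup>2 * w x t) (at x)"
    if "x \<noteq> 0" for x t
  proof (rule has_field_derivative_transform_within_open[OF _ open_nz])
    show "((\<lambda>y. a t / y * w y t) has_real_derivative ((a t)\<^sup>2 - a t) / x\<^sup>2 * w x t) (at x)"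
      by (rule derivative_eq_intros w_x that refl)+
         (use that in \<open>simp add: field_simps power2_eq_square\<close>)
  qed (use that dx in auto)
  have dxx: "deriv_x (deriv_x u) x t = ((a t)\<^sup>2 - a t) / x\<^sup>2 * w x t" if "x \<noteq> 0" for x t
    using DERIV_imp_deriv[OF u_xx[OF that]] by (simp add: deriv_x_def[of "deriv_x u"])
  have u_t: "((\<lambda>s. u x s) has_real_derivative (g1 t + \<gamma> * a t * ln \<bar>x\<bar>) * w x t) (at t)"
    if "x \<noteq> 0" for x t
  proof -
    have "((\<lambda>s. w x s - \<alpha> / \<beta>) has_real_derivative (g1 t + \<gamma> * a t * ln \<bar>x\<bar>) * w x t) (at t)"
      unfolding w_def \<phi>_def g1_def
      by (rule derivative_eq_intros a' g' refl)+ (simp add: algebra_simps add_divide_distrib)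
    moreover have "(\<lambda>s. u x s) = (\<lambda>s. w x s - \<alpha> / \<beta>)"
      using u_w[OF that] by auto
    ultimately show ?thesis by simp
  qed
  have dt: "deriv_t u x t = (g1 t + \<gamma> * a t * ln \<bar>x\<bar>) * w x t" if "x \<noteq> 0" for x t
    using DERIV_imp_deriv[OF u_t[OF that]] by (simp add: deriv_t_def)

  have "continuous_on UNIV a" "continuous_on UNIV g"
    using a' g' by (auto intro!: DERIV_continuous_on)
  then have cont_a: "continuous_on ?\<Omega> (\<lambda>z. a (snd z))"
    and cont_g: "continuous_on ?\<Omega> (\<lambda>z. g (snd z))"
    by (auto intro!: continuous_on_compose2[of UNIV _ _ snd] continuous_intros)
  have cont_ln: "continuous_on ?\<Omega> (\<lambda>z. ln \<bar>fst z\<bar>)"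
    by (auto intro!: continuous_intros)
  have cont_w: "continuous_on ?\<Omega> (\<lambda>z. w (fst z) (snd z))"
    unfolding w_def \<phi>_def by (intro continuous_intros cont_a cont_g cont_ln)
  have cont_g1: "continuous_on ?\<Omega> (\<lambda>z. g1 (snd z))"
    unfolding g1_def by (intro continuous_intros cont_a cont_g)

  have "continuous_on ?\<Omega> (\<lambda>(x, t). u x t)"
  proof (rule continuous_on_eq)
    show "continuous_on ?\<Omega> (\<lambda>z. w (fst z) (snd z) - \<alpha> / \<beta>)"
      by (intro continuous_intros cont_w)
  qed (auto simp: u_w)
  moreover have "continuous_on ?\<Omega> (\<lambda>(x, t). deriv_t u x t)"
  proof (rule continuous_on_eq)
    show "continuous_on ?\<Omega>
            (\<lambda>z. (g1 (snd z) + \<gamma> * a (snd z) * ln \<bar>fst z\<bar>) * w (fst z) (snd z))"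
      by (intro continuous_intros cont_w cont_a cont_g1 cont_ln)
  qed (auto simp: dt)
  moreover have "continuous_on ?\<Omega> (\<lambda>(x, t). deriv_x u x t)"
  proof (rule continuous_on_eq)
    show "continuous_on ?\<Omega> (\<lambda>z. a (snd z) / fst z * w (fst z) (snd z))"
      by (intro continuous_intros cont_w cont_a) auto
  qed (auto simp: dx)
  moreover have "continuous_on ?\<Omega> (\<lambda>(x, t). deriv_x (deriv_x u) x t)"
  proof (rule continuous_on_eq)
    show "continuous_on ?\<Omega>
            (\<lambda>z. ((a (snd z))\<^sup>2 - a (snd z)) / (fst z)\<^sup>2 * w (fst z) (snd z))"
      by (intro continuous_intros cont_w cont_a) auto
  qed (auto simp: dxx)
  moreover have "\<forall>(x, t) \<in> ?\<Omega>. (\<lambda>s. u x s) differentiable (at t) \<and>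
      (\<lambda>y. u y t) differentiable (at x) \<and> (\<lambda>y. deriv_x u y t) differentiable (at x)"
    unfolding real_differentiable_def using u_t u_x u_xx by blast
  ultimately have "C12_on ?\<Omega> u"
    by (simp add: C12_on_def)
  moreover have "deriv_t u x t + 1 / 2 * \<sigma>\<^sup>2 * x\<^sup>2 * deriv_x (deriv_x u) x t + r * x * deriv_x u x t
      + - (\<gamma> / \<beta>) * (\<alpha> + \<beta> * u x t) * (\<delta> + ln \<bar>\<alpha> + \<beta> * u x t\<bar>) = 0" if x: "x \<noteq> 0" for x t
  proof -
    have v: "\<alpha> + \<beta> * u x t = \<beta> * w x t"
      using \<beta> by (simp add: u_w[OF x] algebra_simps)
    \<comment> \<open>Positivity of \<open>\<alpha> + \<beta> u\<close> makes the logarithm in the source term recover the exponent.\<close>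
    have "\<beta> * w x t = exp (\<phi> x t - \<delta>)"
      using \<beta> by (simp add: w_def exp_diff exp_minus field_simps)
    then have ln_v: "\<delta> + ln \<bar>\<beta> * w x t\<bar> = \<phi> x t"
      by simp
    have x_u_x: "r * x * deriv_x u x t = r * a t * w x t"
      and xx_u_xx: "1 / 2 * \<sigma>\<^sup>2 * x\<^sup>2 * deriv_x (deriv_x u) x t
        = \<sigma>\<^sup>2 / 2 * ((a t)\<^sup>2 - a t) * w x t"
      using x by (simp_all add: dx dxx)
    have "- (\<gamma> / \<beta>) * (\<beta> * w x t) * \<phi> x t = - \<gamma> * \<phi> x t * w x t"
      using \<beta> by simp
    then show ?thesis
      unfolding v ln_v x_u_x xx_u_xx dt[OF x] by (simp add: g1_def \<phi>_def algebra_simps)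
  qed
  ultimately show ?thesis
    by (auto simp: semilinear_BS_solution_on_def)
qed

theorem mainTheorem3:
  fixes \<alpha> \<beta> \<gamma> \<delta> r \<sigma> \<kappa> l \<mu> A \<Delta>\<^sub>1 :: real
    and f H R :: "real \<Rightarrow> real"
    and u :: "real \<Rightarrow> real \<Rightarrow> real"
  assumes "\<beta> \<noteq> 0" and "\<gamma> \<noteq> 0" and "\<sigma> \<noteq> 0" and "l \<noteq> 0" and "A > 0"
    and "\<Delta>\<^sub>1 = exp (- \<delta>)"
    and "\<And>\<zeta>. f \<zeta> = - (\<gamma> / \<beta>) * (\<alpha> + \<beta> * \<zeta>) * (\<delta> + ln \<bar>\<alpha> + \<beta> * \<zeta>\<bar>)"
    and "\<And>x t. u x t =
           \<Delta>\<^sub>1 / \<beta> * exp (exp (\<gamma> * t) *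
             (\<sigma> * (\<kappa> * \<sigma> + \<gamma> * \<mu> * (2 * sqrt 2 - 2 * l - \<gamma> * \<mu> * exp (\<gamma> * t) + 2 * \<gamma> * \<sigma> * t))
               - 4 * r * \<gamma>\<^sup>2 * \<mu> * t) / (8 * \<gamma> * \<sigma>))
             * \<bar>x\<bar> powr (\<gamma> * \<mu> / (2 * \<sigma>) * exp (\<gamma> * t)) - \<alpha> / \<beta>"
    and "\<And>t. H t =
           A * exp (1 / 2 * (2 * r - \<sigma>\<^sup>2) * t + 1 / 2 * \<sigma> * (l * t + \<mu> * exp (\<gamma> * t)))"
    and "\<And>t. R t =
           \<Delta>\<^sub>1 / \<beta> * exp (exp (\<gamma> * t) *
             (\<sigma> * (\<gamma> * \<mu> * (2 * sqrt 2 - 2 * l + 2 * \<gamma> * l * t + \<gamma> * \<mu> * exp (\<gamma> * t)) + \<kappa> * \<sigma>)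
               + 4 * \<gamma>\<^sup>2 * \<mu> * ln A) / (8 * \<gamma> * \<sigma>)) - \<alpha> / \<beta>"
  shows "semilinear_BS_solution_on {(x, t). x \<noteq> 0} \<sigma> r f u \<and> barrier_condition u H R"
proof -
  define E where "E t = exp (\<gamma> * t)" for t
  define a where "a t = \<gamma> * \<mu> / (2 * \<sigma>) * E t" for t
  define P where "P t = (\<sigma> * (\<kappa> * \<sigma> + \<gamma> * \<mu> * (2 * sqrt 2 - 2 * l - \<gamma> * \<mu> * E t + 2 * \<gamma> * \<sigma> * t))
                          - 4 * r * \<gamma>\<^sup>2 * \<mu> * t) / (8 * \<gamma> * \<sigma>)" for t
  define g where "g t = E t * P t" for t

  have u_powr: "u x t = \<Delta>\<^sub>1 / \<beta> * exp (g t) * \<bar>x\<bar> powr a t - \<alpha> / \<beta>" for x t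
    unfolding assms(8) by (simp add: g_def P_def a_def E_def)
  have u: "u x t = exp (- \<delta>) / \<beta> * exp (g t + a t * ln \<bar>x\<bar>) - \<alpha> / \<beta>" if "x \<noteq> 0" for x t
    using that by (simp add: u_powr assms(6) powr_def exp_add)

  have E': "(E has_real_derivative \<gamma> * E t) (at t)" for t
    unfolding E_def by (auto intro!: derivative_eq_intros)
  have a': "(a has_real_derivative \<gamma> * a t) (at t)" for t
    unfolding a_def by (rule derivative_eq_intros E' refl)+ (simp_all add: assms(3))
  have P': "(P has_real_derivative
      (\<sigma> * (\<gamma> * \<mu> * (2 * \<gamma> * \<sigma> - \<gamma> * \<mu> * (\<gamma> * E t))) - 4 * r * \<gamma>\<^sup>2 * \<mu>) / (8 * \<gamma> * \<sigma>)) (at t)" for t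
    unfolding P_def by (rule DERIV_cdivide, (rule derivative_eq_intros E' refl)+) (simp add: algebra_simps)
  have g': "(g has_real_derivative \<gamma> * g t - \<sigma>\<^sup>2 / 2 * ((a t)\<^sup>2 - a t) - r * a t) (at t)" for t
  proof -
    let ?P1 = "(\<sigma> * (\<gamma> * \<mu> * (2 * \<gamma> * \<sigma> - \<gamma> * \<mu> * (\<gamma> * E t))) - 4 * r * \<gamma>\<^sup>2 * \<mu>) / (8 * \<gamma> * \<sigma>)"
    have "(g has_real_derivative \<gamma> * g t + E t * ?P1) (at t)"
      unfolding g_def by (rule derivative_eq_intros E' P' refl)+ simp
    moreover have "E t * ?P1 = - (\<sigma>\<^sup>2 / 2 * ((a t)\<^sup>2 - a t) + r * a t)"
      using assms(2,3) by (simp add: a_def field_simps power2_eq_square)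
    ultimately show ?thesis
      by (simp only: add_uminus_conv_diff diff_diff_eq)
  qed
  have f: "f = (\<lambda>\<zeta>. - (\<gamma> / \<beta>) * (\<alpha> + \<beta> * \<zeta>) * (\<delta> + ln \<bar>\<alpha> + \<beta> * \<zeta>\<bar>))"
    using assms(7) by (rule ext)
  have "semilinear_BS_solution_on {(x, t). x \<noteq> 0} \<sigma> r f u"
    unfolding f by (rule log_affine_exponent_solution[OF assms(1) a' g' u])
  moreover have "u (H t) t = R t" for t
  proof -
    have H: "H t > 0"
      using assms(5,9) by simp
    have ln_H: "ln (H t) = ln A + (1 / 2 * (2 * r - \<sigma>\<^sup>2) * t + 1 / 2 * \<sigma> * (l * t + \<mu> * E t))"
      using assms(5) by (simp add: assms(9) ln_mult E_def)
    have "g t + a t * ln \<bar>H t\<bar> = E t *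
        (\<sigma> * (\<gamma> * \<mu> * (2 * sqrt 2 - 2 * l + 2 * \<gamma> * l * t + \<gamma> * \<mu> * E t) + \<kappa> * \<sigma>)
          + 4 * \<gamma>\<^sup>2 * \<mu> * ln A) / (8 * \<gamma> * \<sigma>)"
      using H assms(2,3)
      by (simp add: ln_H g_def P_def a_def field_simps power2_eq_square)
    then show ?thesis
      using u[of "H t" t] H by (simp add: assms(6,10) E_def)
  qed
  ultimately show ?thesis
    by (simp add: barrier_condition_def)
qed

end
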